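(* Let $K$ be a field, let $G$ be a finite simple graph on $n$ vertices $x_1,\ldots,x_n$ which is not the complete graph $K_n$, and let $k=\kappa(G)$ be its vertex connectivity. Let $S=K[x_1,\ldots,x_n]$, let $I(G^c)\subset S$ be the edge ideal of the complementary graph $G^c$ of $G$, and let $I(G^c)^2$ be its second (ordinary) power. Then $$\operatorname{depth}\, S/I(G^c)^{2}\;\geq\;\left\lceil\frac{k}{2(n-k-1)}\right\rceil-1.$$
   Context: All graphs are finite and simple. For a graph $G$ with vertex set $V(G)$ and $W\subset V(G)$, $G-W$ denotes the induced subgraph of $G$ on $V(G)\setminus W$. If $G$ is not a complete graph, the vertex connectivity $\kappa(G)$ is the smallest cardinality of a subset $W\subset V(G)$ for which $G-W$ is disconnected (so $\kappa(G)=0$ if and only if $G$ is disconnected). The complementary graph $G^c$ has the same vertex set as $G$, and two distinct vertices are adjacent in $G^c$ if and only if they are not adjacent in $G$. For a graph $H$ on the vertex set $\{x_1,\ldots,x_n\}$, the edge ideal of $H$ is $I(H)=(x_ix_j : 1\leq i<j\leq n,\ \{x_i,x_j\}\in E(H))\subset S=K[x_1,\ldots,x_n]$, where vertices are identified with variables. Depth is taken with respect to the graded maximal ideal $(x_1,\ldots,x_n)$ of $S$. *)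

theory Defs
  imports
    "HOL-Library.Poly_Mapping"
    "HOL-Library.Extended_Real"
    "Graph_Theory.Graph_Theory"
begin

section \<open>Graphs\<close>

text \<open>Finite simple graphs are the symmetric loop-free digraphs \<^locale>\<open>pair_graph\<close>:
  an edge \<open>{u,v}\<close> is the pair of arcs \<open>(u,v)\<close> and \<open>(v,u)\<close>.\<close>

definition complement_graph :: "'v pair_pre_digraph \<Rightarrow> 'v pair_pre_digraph" where
  "complement_graph G =
     \<lparr> pverts = pverts G,
       parcs = {(u, v). u \<in> pverts G \<and> v \<in> pverts G \<and> u \<noteq> v \<and> (u, v) \<notin> parcs G} \<rparr>"

definition delete_vertices :: "'v pair_pre_digraph \<Rightarrow> 'v set \<Rightarrow> ('v, 'v \<times> 'v) pre_digraph" where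
  "delete_vertices G W = induce_subgraph (with_proj G) (pverts G - W)"

text \<open>Meant for non-complete graphs only (for complete graphs no such \<open>W\<close> exists and the value
  is unspecified). The set \<open>W\<close> is proper because the graph without vertices does not count
  as connected in the library.\<close>

definition vertex_connectivity :: "'v pair_pre_digraph \<Rightarrow> nat" where
  "vertex_connectivity G =
     (LEAST k. \<exists>W. W \<subset> pverts G \<and> card W = k
                 \<and> \<not> Digraph_Component.connected (delete_vertices G W))"


section \<open>Ideals in commutative rings\<close>

text \<open>Ideals are the submodules of the ring as a module over itself, so \<open>ideal.span A\<close> is
  the ideal generated by \<open>A\<close>.\<close>

interpretation ideal: module "(*) :: 'a::comm_ring_1 \<Rightarrow> 'a \<Rightarrow> 'a"
  by unfold_locales (simp_all add: algebra_simps)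

primrec ideal_power :: "'a::comm_ring_1 set \<Rightarrow> nat \<Rightarrow> 'a set" where
  "ideal_power I 0 = UNIV"
| "ideal_power I (Suc m) = ideal.span {a * b | a b. a \<in> I \<and> b \<in> ideal_power I m}"

text \<open>For an ideal \<open>J\<close> of \<open>R\<close>, the sequence \<open>f\<^sub>1, \<dots>, f\<^sub>r\<close> is regular on \<open>M = R/J\<close> if each \<open>f\<^sub>i\<close>
  is a nonzerodivisor on \<open>M/(f\<^sub>1, \<dots>, f\<^sub>i\<^sub>-\<^sub>1)M = R/(J + (f\<^sub>1, \<dots>, f\<^sub>i\<^sub>-\<^sub>1))\<close>
  and \<open>M/(f\<^sub>1, \<dots>, f\<^sub>r)M\<close> is nonzero.\<close>

definition regular_sequence_on_quotient :: "'a::comm_ring_1 set \<Rightarrow> 'a list \<Rightarrow> bool" where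
  "regular_sequence_on_quotient J fs \<longleftrightarrow>
     (\<forall>i < length fs. \<forall>g. fs ! i * g \<in> ideal.span (J \<union> set (take i fs))
                          \<longrightarrow> g \<in> ideal.span (J \<union> set (take i fs)))
     \<and> ideal.span (J \<union> set fs) \<noteq> UNIV"

text \<open>The grade of an ideal \<open>\<aa>\<close> on \<open>M = R/J\<close>: the supremum of the lengths of the \<open>M\<close>-regular
  sequences in \<open>\<aa>\<close>, with the usual convention that it is \<open>\<infinity>\<close> if \<open>\<aa>M = M\<close>, i.e.\ \<open>J + \<aa> = R\<close>.\<close>

definition grade_on_quotient :: "'a::comm_ring_1 set \<Rightarrow> 'a set \<Rightarrow> enat" where
  "grade_on_quotient \<aa> J =
     (if ideal.span (J \<union> \<aa>) = UNIV then \<infinity>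
      else Sup {enat (length fs) | fs. set fs \<subseteq> \<aa> \<and> regular_sequence_on_quotient J fs})"


section \<open>Polynomial rings and edge ideals\<close>

text \<open>The polynomial ring over \<open>'k\<close> with one variable for each element of the finite type \<open>'v\<close>.\<close>

type_synonym ('v, 'k) mv_poly = "('v \<Rightarrow>\<^sub>0 nat) \<Rightarrow>\<^sub>0 'k"

definition Var :: "'v \<Rightarrow> ('v, 'k::comm_ring_1) mv_poly" where
  "Var v = Poly_Mapping.single (Poly_Mapping.single v 1) 1"

definition graded_maximal_ideal :: "('v::finite, 'k::field) mv_poly set" where
  "graded_maximal_ideal = ideal.span (range Var)"

definition depth_quotient :: "('v::finite, 'k::field) mv_poly set \<Rightarrow> enat" where
  "depth_quotient J = grade_on_quotient graded_maximal_ideal J"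

definition edge_ideal :: "'v::finite pair_pre_digraph \<Rightarrow> ('v, 'k::field) mv_poly set" where
  "edge_ideal H = ideal.span {Var u * Var v | u v. (u, v) \<in> parcs H}"

end

theory Submission
  imports Defs
begin

text \<open>Write \<open>d = n - k - 1\<close>. Deleting the neighbours of a vertex disconnects \<open>G\<close>, so the complement
  \<open>H\<close> of \<open>G\<close> has maximum degree at most \<open>d\<close>, and a regular sequence of length \<open>t\<close> is needed
  whenever \<open>n > 2dt + d\<close>. The elementary symmetric polynomials \<open>e\<^sub>1, \<dots>, e\<^sub>t\<close> form a regular
  sequence modulo every prime generated by variables with at least \<open>t\<close> variables left over, and
  a sequence that is regular on \<open>S/(J : f)\<close> and on \<open>S/(J + (f))\<close> is regular on \<open>S/J\<close>. Hence it
  suffices to split \<open>I(H)\<^sup>2\<close> repeatedly by monomials until only such primes remain.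
  Splitting by the edges leads to \<open>I(H)\<close> and to ideals \<open>(I(H)\<^sup>2 : ab) + (Y)\<close> with \<open>Y\<close> a set of
  variables; the latter are \<open>I(H) + (y y' : y \<in> N(a), y' \<in> N(b)) + (Y)\<close>, and splitting by the
  neighbours of \<open>a\<close> and \<open>b\<close> leaves edge ideals of induced subgraphs of \<open>H\<close> that miss at most
  \<open>3d\<close> vertices.\<close>

text \<open>As simplification rules these fight with \<open>algebra_simps\<close> and with \<open>ideal.span J = J\<close>.\<close>

declare ideal.scale_scale [simp del] and ideal.span_eq_iff [simp del]

section \<open>Weakly regular sequences\<close>

text \<open>The last quotient may be zero here, because a colon ideal \<open>J : x\<close> can be
  the whole ring; properness is checked once, in \<open>depth_quotient_ge\<close>. Cancellation is
  tested in \<open>J\<close> itself, so \<open>J\<close> is meant to be an ideal.\<close>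

primrec weakly_regular :: "'a::comm_ring_1 set \<Rightarrow> 'a list \<Rightarrow> bool" where
  "weakly_regular J [] \<longleftrightarrow> True"
| "weakly_regular J (f # fs) \<longleftrightarrow>
     (\<forall>g. f * g \<in> J \<longrightarrow> g \<in> J) \<and> weakly_regular (ideal.span (insert f J)) fs"

lemma mem_span_insert_iff:
  fixes J :: "'a::comm_ring_1 set"
  assumes "ideal.subspace J"
  shows "g \<in> ideal.span (insert f J) \<longleftrightarrow> (\<exists>h. g - f * h \<in> J)"
  using assms by (simp add: ideal.span_breakdown_eq mult.commute ideal.span_eq_iff[THEN iffD2])

lemma span_insert_span_insert:
  fixes J :: "'a::comm_ring_1 set"
  shows "ideal.span (insert x (ideal.span (insert f J))) = ideal.span (insert x (insert f J))"
proof
  show "ideal.span (insert x (ideal.span (insert f J))) \<subseteq> ideal.span (insert x (insert f J))"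
    by (intro ideal.span_minimal insert_subsetI ideal.span_mono ideal.subspace_span)
      (auto intro: ideal.span_base)
  show "ideal.span (insert x (insert f J)) \<subseteq> ideal.span (insert x (ideal.span (insert f J)))"
    by (rule ideal.span_mono) (auto intro: ideal.span_base)
qed

lemma span_insert_commute:
  fixes J :: "'a::comm_ring_1 set"
  shows "ideal.span (insert x (ideal.span (insert f J))) = ideal.span (insert f (ideal.span (insert x J)))"
  by (simp add: span_insert_span_insert insert_commute)

text \<open>Passage to the indexed condition of \<open>regular_sequence_on_quotient\<close>: once
  the head \<open>f\<close> is moved into the ideal, position \<open>i\<close> becomes position
  \<open>i - 1\<close> of the tail over \<open>J + (f)\<close>.\<close>

lemma weakly_regular_span:
  fixes J :: "'a::comm_ring_1 set"
  assumes "ideal.subspace J" "weakly_regular J fs" "i < length fs"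
    and "fs ! i * g \<in> ideal.span (J \<union> set (take i fs))"
  shows "g \<in> ideal.span (J \<union> set (take i fs))"
  using assms
proof (induction fs arbitrary: J i)
  case (Cons f fs)
  show ?case
  proof (cases i)
    case 0
    moreover have "ideal.span J = J" using Cons.prems(1) by (simp add: ideal.span_eq_iff)
    ultimately show ?thesis using Cons.prems by auto
  next
    case (Suc j)
    let ?J = "ideal.span (insert f J)"
    have *: "ideal.span (?J \<union> set (take j fs)) = ideal.span (J \<union> set (take i (f # fs)))"
    proof
      show "ideal.span (?J \<union> set (take j fs)) \<subseteq> ideal.span (J \<union> set (take i (f # fs)))"
        using Suc by (intro ideal.span_minimal Un_least ideal.span_mono ideal.subspace_span)
          (auto intro: ideal.span_base)
      show "ideal.span (J \<union> set (take i (f # fs))) \<subseteq> ideal.span (?J \<union> set (take j fs))"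
        using Suc by (intro ideal.span_mono) (auto intro: ideal.span_base)
    qed
    show ?thesis
      using Cons.IH[of ?J j] Cons.prems Suc unfolding * by simp
  qed
qed simp

lemma subspace_colon:
  fixes J :: "'a::comm_ring_1 set"
  shows "ideal.subspace J \<Longrightarrow> ideal.subspace {g. x * g \<in> J}"
  unfolding ideal.subspace_def by (auto simp: distrib_left mult.left_commute)

text \<open>The exact sequence \<open>0 \<rightarrow> R/(J : x) \<rightarrow> R/J \<rightarrow> R/(J + (x)) \<rightarrow> 0\<close>, which stays exact modulo
  an element that is regular on \<open>R/(J + (x))\<close>.\<close>

lemma weakly_regular_colon_sum:
  fixes J :: "'a::comm_ring_1 set"
  assumes "ideal.subspace J"
    and "weakly_regular {g. x * g \<in> J} fs"
    and "weakly_regular (ideal.span (insert x J)) fs"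
  shows "weakly_regular J fs"
  using assms
proof (induction fs arbitrary: J)
  case (Cons f fs)
  note sub = Cons.prems(1)
  have regc: "x * g \<in> J" if "x * (f * g) \<in> J" for g
    using Cons.prems(2) that by simp
  have regs: "g \<in> ideal.span (insert x J)" if "f * g \<in> ideal.span (insert x J)" for g
    using Cons.prems(3) that by simp
  \<comment> \<open>Regularity on \<open>R/(J + (x))\<close> gives \<open>g = x * h\<close> modulo
    \<open>J\<close>; then \<open>f * h\<close> lies in \<open>J : x\<close>, and regularity there
    removes \<open>f\<close>.\<close>
  have reg: "g \<in> J" if fg: "f * g \<in> J" for g
  proof -
    have "g \<in> ideal.span (insert x J)"
      by (rule regs, rule ideal.span_base) (simp add: fg)
    then obtain h where h: "g - x * h \<in> J"
      using mem_span_insert_iff[OF sub] by blast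
    have "f * g - f * (g - x * h) \<in> J"
      using ideal.subspace_diff[OF sub fg ideal.subspace_scale[OF sub h]] .
    then have "x * (f * h) \<in> J" by (simp add: algebra_simps)
    then have "x * h \<in> J" by (rule regc)
    then show ?thesis using ideal.subspace_add[OF sub h, of "x * h"] by simp
  qed
  let ?J = "ideal.span (insert f J)"
  \<comment> \<open>Exactness modulo \<open>f\<close>: if \<open>x * g = f * h\<close> modulo
    \<open>J\<close>, then \<open>f\<close> cancels modulo \<open>J + (x)\<close>, so
    \<open>h = x * h'\<close> modulo \<open>J\<close> and \<open>g - f * h'\<close> lies in
    \<open>J : x\<close>.\<close>
  have "{g. x * g \<in> ?J} = ideal.span (insert f {g. x * g \<in> J})"
  proof (intro set_eqI iffI)
    fix g assume "g \<in> {g. x * g \<in> ?J}"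
    then obtain h where h: "x * g - f * h \<in> J"
      using mem_span_insert_iff[OF sub] by blast
    have "f * h - x * g \<in> J" using ideal.subspace_neg[OF sub h] by simp
    then have "f * h \<in> ideal.span (insert x J)" using mem_span_insert_iff[OF sub] by blast
    then obtain h' where h': "h - x * h' \<in> J"
      using regs mem_span_insert_iff[OF sub] by blast
    have "(x * g - f * h) + f * (h - x * h') \<in> J"
      using ideal.subspace_add[OF sub h ideal.subspace_scale[OF sub h']] .
    then have "x * (g - f * h') \<in> J" by (simp add: algebra_simps)
    then show "g \<in> ideal.span (insert f {g. x * g \<in> J})"
      using mem_span_insert_iff[OF subspace_colon[OF sub]] by blast
  next
    fix g assume "g \<in> ideal.span (insert f {g. x * g \<in> J})"
    then obtain h where "x * (g - f * h) \<in> J"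
      using mem_span_insert_iff[OF subspace_colon[OF sub]] by blast
    then have "x * g - f * (x * h) \<in> J" by (simp add: algebra_simps)
    then show "g \<in> {g. x * g \<in> ?J}" using mem_span_insert_iff[OF sub] by blast
  qed
  then have "weakly_regular {g. x * g \<in> ?J} fs"
    using Cons.prems(2) by simp
  moreover have "weakly_regular (ideal.span (insert x ?J)) fs"
    using Cons.prems(3) by (simp add: span_insert_commute)
  ultimately have "weakly_regular ?J fs" using Cons.IH[of ?J] by simp
  then show ?case using reg by simp
qed simp

text \<open>The \<open>foldl\<close> is the ideal \<open>J + (fs)\<close>, built one generator at a
  time as in the recursion of \<open>weakly_regular\<close>.\<close>

lemma weakly_regular_snoc:
  fixes J :: "'a::comm_ring_1 set"
  shows "weakly_regular J (fs @ [f]) \<longleftrightarrow>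
    weakly_regular J fs \<and>
    (\<forall>g. f * g \<in> foldl (\<lambda>J f. ideal.span (insert f J)) J fs
      \<longrightarrow> g \<in> foldl (\<lambda>J f. ideal.span (insert f J)) J fs)"
  by (induction fs arbitrary: J) auto

lemma subspace_foldl_span_insert:
  fixes J :: "'a::comm_ring_1 set"
  shows "ideal.subspace J \<Longrightarrow> ideal.subspace (foldl (\<lambda>J f. ideal.span (insert f J)) J fs)"
  by (induction fs arbitrary: J) auto

lemma subset_foldl_span_insert:
  fixes J :: "'a::comm_ring_1 set"
  shows "J \<subseteq> foldl (\<lambda>J f. ideal.span (insert f J)) J fs"
proof (induction fs arbitrary: J)
  case (Cons f fs)
  have "J \<subseteq> ideal.span (insert f J)" by (auto intro: ideal.span_base)
  with Cons[of "ideal.span (insert f J)"] show ?case by simp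
qed simp

section \<open>Monomial ideals\<close>

text \<open>A monomial ideal is encoded by its exponents: for upward closed \<open>U\<close>, colons
  and sums with a monomial become operations on \<open>U\<close> that do not involve
  coefficients.\<close>

definition monomial_ideal :: "('v \<Rightarrow>\<^sub>0 nat) set \<Rightarrow> ('v, 'k::comm_ring_1) mv_poly set" where
  "monomial_ideal U = {p. Poly_Mapping.keys p \<subseteq> U}"

definition upward_closed :: "('v \<Rightarrow>\<^sub>0 nat) set \<Rightarrow> bool" where
  "upward_closed U \<longleftrightarrow> (\<forall>m\<in>U. \<forall>m'. m + m' \<in> U)"

lemma upward_closedD: "upward_closed U \<Longrightarrow> m \<in> U \<Longrightarrow> m + m' \<in> U"
  by (simp add: upward_closed_def)

lemma mem_keys_multE:
  assumes "m \<in> Poly_Mapping.keys (f * g)"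
  obtains a b where "m = a + b" "a \<in> Poly_Mapping.keys f" "b \<in> Poly_Mapping.keys g"
  using assms keys_mult[of f g] by blast

lemma subspace_monomial_ideal:
  assumes "upward_closed U"
  shows "ideal.subspace (monomial_ideal U :: ('v, 'k::comm_ring_1) mv_poly set)"
proof (rule ideal.subspaceI)
  fix p q :: "('v, 'k) mv_poly"
  assume p: "p \<in> monomial_ideal U"
  have "m \<in> U" if "m \<in> Poly_Mapping.keys (q * p)" for m
  proof -
    from that obtain a b where "m = a + b" "b \<in> Poly_Mapping.keys p"
      by (rule mem_keys_multE)
    then show ?thesis
      using p upward_closedD[OF assms, of b a] by (auto simp: monomial_ideal_def add.commute)
  qed
  then show "q * p \<in> monomial_ideal U" by (auto simp: monomial_ideal_def)
  assume "q \<in> monomial_ideal U"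
  then show "p + q \<in> monomial_ideal U"
    using keys_add[of p q] p by (auto simp: monomial_ideal_def)
qed (simp add: monomial_ideal_def)

lemma mem_subspace_if_monomials:
  fixes p :: "('v, 'k::comm_ring_1) mv_poly"
  assumes "ideal.subspace S" and "\<And>m. m \<in> Poly_Mapping.keys p \<Longrightarrow> Poly_Mapping.single m 1 \<in> S"
  shows "p \<in> S"
proof -
  have "p = (\<Sum>m\<in>Poly_Mapping.keys p. Poly_Mapping.single m (Poly_Mapping.lookup p m))"
    by (rule poly_mapping_eqI) (simp add: lookup_sum lookup_single when_def in_keys_iff)
  also have "\<dots> = (\<Sum>m\<in>Poly_Mapping.keys p.
      Poly_Mapping.single 0 (Poly_Mapping.lookup p m) * Poly_Mapping.single m 1)"
    by (simp add: mult_single)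
  also have "\<dots> \<in> S"
    using assms by (intro ideal.subspace_sum ideal.subspace_scale)
  finally show ?thesis .
qed

lemma span_monomials:
  "ideal.span ((\<lambda>f. Poly_Mapping.single f 1) ` B) =
    (monomial_ideal {f + m | f m. f \<in> B} :: ('v, 'k::comm_ring_1) mv_poly set)"
proof
  have "upward_closed {f + m | f m. f \<in> B}"
    by (fastforce simp: upward_closed_def add.assoc)
  moreover have "f \<in> {f + m | f m. f \<in> B}" if "f \<in> B" for f
    proof -
    have "f = f + 0" by simp
    with that show ?thesis by blast
  qed
  ultimately show "ideal.span ((\<lambda>f. Poly_Mapping.single f 1) ` B) \<subseteq>
      (monomial_ideal {f + m | f m. f \<in> B} :: ('v, 'k) mv_poly set)"
    by (intro ideal.span_minimal subspace_monomial_ideal) (auto simp: monomial_ideal_def)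
  show "(monomial_ideal {f + m | f m. f \<in> B} :: ('v, 'k) mv_poly set) \<subseteq>
      ideal.span ((\<lambda>f. Poly_Mapping.single f 1) ` B)"
  proof
    fix p :: "('v, 'k) mv_poly"
    assume p: "p \<in> monomial_ideal {f + m | f m. f \<in> B}"
    have gen: "Poly_Mapping.single (f + m) 1 \<in>
        ideal.span ((\<lambda>f. Poly_Mapping.single f (1::'k)) ` B)" if "f \<in> B" for f m
    proof -
      have "Poly_Mapping.single (f + m) (1::'k) = Poly_Mapping.single m 1 * Poly_Mapping.single f 1"
        by (simp add: mult_single add.commute)
      then show ?thesis using that by (simp add: ideal.span_scale ideal.span_base)
    qed
    show "p \<in> ideal.span ((\<lambda>f. Poly_Mapping.single f 1) ` B)"
      by (rule mem_subspace_if_monomials) (use p gen in \<open>auto simp: monomial_ideal_def\<close>)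
  qed
qed

lemma lookup_single_mult:
  fixes g :: "('v, 'k::comm_ring_1) mv_poly"
  shows "Poly_Mapping.lookup (Poly_Mapping.single f 1 * g) (f + m) = Poly_Mapping.lookup g m"
  by (simp add: lookup_mult lookup_single when_mult)

text \<open>Multiplication by a monomial translates the support injectively and keeps the
  coefficients, so nothing cancels.\<close>

lemma colon_monomial_ideal:
  "{g. Poly_Mapping.single f 1 * g \<in> monomial_ideal U} =
    (monomial_ideal {m. f + m \<in> U} :: ('v, 'k::comm_ring_1) mv_poly set)"
proof (intro set_eqI iffI)
  fix g :: "('v, 'k) mv_poly"
  assume "g \<in> {g. Poly_Mapping.single f 1 * g \<in> monomial_ideal U}"
  then have "f + m \<in> U" if "m \<in> Poly_Mapping.keys g" for m
    using that lookup_single_mult[of f g m] by (auto simp: monomial_ideal_def in_keys_iff subset_iff)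
  then show "g \<in> monomial_ideal {m. f + m \<in> U}" by (auto simp: monomial_ideal_def)
next
  fix g :: "('v, 'k) mv_poly"
  assume "g \<in> monomial_ideal {m. f + m \<in> U}"
  then show "g \<in> {g. Poly_Mapping.single f 1 * g \<in> monomial_ideal U}"
    by (auto simp: monomial_ideal_def elim!: mem_keys_multE split: if_splits)
qed

lemma span_insert_monomial_ideal:
  assumes "upward_closed U"
  shows "ideal.span (insert (Poly_Mapping.single f 1) (monomial_ideal U)) =
    (monomial_ideal (U \<union> range ((+) f)) :: ('v, 'k::comm_ring_1) mv_poly set)"
proof
  have "upward_closed (U \<union> range ((+) f))"
    using assms unfolding upward_closed_def by (auto simp: add.assoc)
  moreover have "f \<in> range ((+) f)" by (rule range_eqI[of _ _ 0]) simp
  ultimately show "ideal.span (insert (Poly_Mapping.single f 1) (monomial_ideal U)) \<subseteq>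
      (monomial_ideal (U \<union> range ((+) f)) :: ('v, 'k) mv_poly set)"
    by (intro ideal.span_minimal subspace_monomial_ideal) (auto simp: monomial_ideal_def)
  show "(monomial_ideal (U \<union> range ((+) f)) :: ('v, 'k) mv_poly set) \<subseteq>
      ideal.span (insert (Poly_Mapping.single f 1) (monomial_ideal U))"
  proof
    fix p :: "('v, 'k) mv_poly"
    assume p: "p \<in> monomial_ideal (U \<union> range ((+) f))"
    have gen: "Poly_Mapping.single m (1::'k) \<in> ideal.span (insert (Poly_Mapping.single f 1) (monomial_ideal U))"
      if "m \<in> U \<union> range ((+) f)" for m
    proof (cases "m \<in> U")
      case True
      then show ?thesis by (intro ideal.span_base) (simp add: monomial_ideal_def)
    next
      case False
      with that obtain m' where "m = f + m'" by blast
      then have "Poly_Mapping.single m (1::'k) = Poly_Mapping.single m' 1 * Poly_Mapping.single f 1"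
        by (simp add: mult_single add.commute)
      then show ?thesis by (simp add: ideal.span_scale ideal.span_base)
    qed
    show "p \<in> ideal.span (insert (Poly_Mapping.single f 1) (monomial_ideal U))"
      by (rule mem_subspace_if_monomials) (use p gen in \<open>auto simp: monomial_ideal_def\<close>)
  qed
qed

text \<open>The splitting principle in terms of exponents alone; every splitting of a monomial ideal
  below goes through it.\<close>

lemma weakly_regular_monomial_split:
  fixes fs :: "('v, 'k::comm_ring_1) mv_poly list"
  assumes "upward_closed U"
    and "weakly_regular (monomial_ideal {m. f + m \<in> U}) fs"
    and "weakly_regular (monomial_ideal (U \<union> range ((+) f))) fs"
  shows "weakly_regular (monomial_ideal U) fs"
  using weakly_regular_colon_sum[OF subspace_monomial_ideal[OF assms(1)], of "Poly_Mapping.single f 1" fs] assms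
  by (simp add: colon_monomial_ideal span_insert_monomial_ideal)

section \<open>Elementary symmetric polynomials modulo variables\<close>

definition monomial_degree :: "('v::finite \<Rightarrow>\<^sub>0 nat) \<Rightarrow> nat" where
  "monomial_degree m = (\<Sum>v\<in>UNIV. Poly_Mapping.lookup m v)"

lemma monomial_degree_add: "monomial_degree (m + m') = monomial_degree m + monomial_degree m'"
  by (simp add: monomial_degree_def lookup_add sum.distrib)

definition homogeneous :: "nat \<Rightarrow> ('v::finite, 'k::comm_ring_1) mv_poly \<Rightarrow> bool" where
  "homogeneous e f \<longleftrightarrow> (\<forall>m\<in>Poly_Mapping.keys f. monomial_degree m = e)"

lemma homogeneous_mult: "homogeneous a f \<Longrightarrow> homogeneous b g \<Longrightarrow> homogeneous (a + b) (f * g)"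
  by (auto simp: homogeneous_def monomial_degree_add elim!: mem_keys_multE)

lemma homogeneous_power: "homogeneous 1 x \<Longrightarrow> homogeneous k (x ^ k)"
proof (induction k)
  case (Suc k)
  then show ?case using homogeneous_mult[of 1 x k "x ^ k"] by simp
qed (simp add: homogeneous_def monomial_degree_def)

definition restrict_keys ::
  "('v \<Rightarrow>\<^sub>0 nat) set \<Rightarrow> ('v, 'k::comm_ring_1) mv_poly \<Rightarrow> ('v, 'k) mv_poly" where
  "restrict_keys S p = Abs_poly_mapping (\<lambda>m. Poly_Mapping.lookup p m when m \<in> S)"

lemma lookup_restrict_keys:
  "Poly_Mapping.lookup (restrict_keys S p) m = (Poly_Mapping.lookup p m when m \<in> S)"
proof -
  have "finite {m. (Poly_Mapping.lookup p m when m \<in> S) \<noteq> 0}"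
    by (rule finite_subset[OF _ finite_keys[of p]]) (auto simp: in_keys_iff)
  then show ?thesis by (simp add: restrict_keys_def)
qed

lemma keys_restrict_keys: "Poly_Mapping.keys (restrict_keys S p) = Poly_Mapping.keys p \<inter> S"
  by (auto simp: in_keys_iff lookup_restrict_keys)

text \<open>For ideals this is the usual gradedness: homogeneous components are differences of
  consecutive truncations, and truncations are sums of components.\<close>

definition graded_ideal :: "('v::finite, 'k::comm_ring_1) mv_poly set \<Rightarrow> bool" where
  "graded_ideal J \<longleftrightarrow> (\<forall>p\<in>J. \<forall>d. restrict_keys {m. monomial_degree m \<le> d} p \<in> J)"

lemma restrict_keys_diff: "restrict_keys S (p - q) = restrict_keys S p - restrict_keys S q"
  by (rule poly_mapping_eqI) (simp add: lookup_restrict_keys lookup_minus when_def)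

text \<open>Multiplication by \<open>f\<close> raises every degree by exactly \<open>e\<close>. The
  bound has the form \<open>e + monomial_degree m \<le> d\<close> because \<open>d - e\<close> on
  naturals would keep constant terms when \<open>d < e\<close>.\<close>

lemma restrict_keys_homogeneous_mult:
  assumes "homogeneous e f"
  shows "restrict_keys {m. monomial_degree m \<le> d} (f * h) =
    f * restrict_keys {m. e + monomial_degree m \<le> d} h"
proof (rule poly_mapping_eqI)
  fix m
  let ?r = "restrict_keys {m. e + monomial_degree m \<le> d} h"
  let ?s = "restrict_keys {m. \<not> e + monomial_degree m \<le> d} h"
  have h: "h = ?r + ?s"
    by (rule poly_mapping_eqI) (simp add: lookup_restrict_keys lookup_add when_def)
  have "f * h = f * ?r + f * ?s" by (subst h) (simp add: distrib_left)
  then have *: "Poly_Mapping.lookup (f * h) m = Poly_Mapping.lookup (f * ?r) m + Poly_Mapping.lookup (f * ?s) m"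
    by (simp add: lookup_add)
  have "m \<notin> Poly_Mapping.keys (f * ?s)" if "monomial_degree m \<le> d"
    using assms that
    by (auto simp: homogeneous_def keys_restrict_keys monomial_degree_add elim!: mem_keys_multE)
  moreover have "m \<notin> Poly_Mapping.keys (f * ?r)" if "\<not> monomial_degree m \<le> d"
    using assms that
    by (auto simp: homogeneous_def keys_restrict_keys monomial_degree_add elim!: mem_keys_multE)
  ultimately show "Poly_Mapping.lookup (restrict_keys {m. monomial_degree m \<le> d} (f * h)) m =
      Poly_Mapping.lookup (f * ?r) m"
    using * by (auto simp: lookup_restrict_keys when_def in_keys_iff)
qed

lemma graded_ideal_span_insert:
  assumes "ideal.subspace J" "graded_ideal J" "homogeneous e f"
  shows "graded_ideal (ideal.span (insert f J))"
  unfolding graded_ideal_def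
proof (intro ballI allI)
  fix p d assume "p \<in> ideal.span (insert f J)"
  then obtain h where "p - f * h \<in> J" using mem_span_insert_iff[OF assms(1)] by blast
  then have "restrict_keys {m. monomial_degree m \<le> d} (p - f * h) \<in> J"
    using assms(2) by (auto simp: graded_ideal_def)
  then show "restrict_keys {m. monomial_degree m \<le> d} p \<in> ideal.span (insert f J)"
    using mem_span_insert_iff[OF assms(1)]
    by (auto simp: restrict_keys_diff restrict_keys_homogeneous_mult[OF assms(3)])
qed

text \<open>Graded Krull intersection: modulo \<open>J\<close>, the elements of \<open>A\<close> are divisible by every power
  of \<open>x\<close>.\<close>

lemma subset_graded_ideal_if_divisible:
  fixes J :: "('v::finite, 'k::comm_ring_1) mv_poly set"
  assumes sub: "ideal.subspace J" and gr: "graded_ideal J" and x: "homogeneous 1 x"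
    and div: "\<And>g. g \<in> A \<Longrightarrow> \<exists>h\<in>A. g - x * h \<in> J"
  shows "A \<subseteq> J"
proof
  have pow: "\<exists>h\<in>A. g - x ^ k * h \<in> J" if "g \<in> A" for g k
    using that
  proof (induction k)
    case 0
    then show ?case using ideal.subspace_0[OF sub] by (intro bexI[of _ g]) simp_all
  next
    case (Suc k)
    then obtain h where h: "h \<in> A" "g - x ^ k * h \<in> J" by blast
    then obtain h' where h': "h' \<in> A" "h - x * h' \<in> J" using div by blast
    have "(g - x ^ k * h) + x ^ k * (h - x * h') \<in> J"
      using ideal.subspace_add[OF sub h(2) ideal.subspace_scale[OF sub h'(2)]] .
    then have "g - x ^ Suc k * h' \<in> J" by (simp add: algebra_simps)
    with h' show ?case by blast
  qed
  fix g assume g: "g \<in> A"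
  \<comment> \<open>Any bound for the degrees in \<open>g\<close> serves; a sum also covers
    \<open>g = 0\<close>. Truncation at \<open>d\<close> keeps \<open>g\<close> and kills every
    multiple of \<open>x ^ Suc d\<close>.\<close>
  define d where "d = (\<Sum>m\<in>Poly_Mapping.keys g. monomial_degree m)"
  have d: "monomial_degree m \<le> d" if "m \<in> Poly_Mapping.keys g" for m
    unfolding d_def using that by (intro member_le_sum) auto
  obtain h where "g - x ^ Suc d * h \<in> J" using pow[OF g] by blast
  then have "restrict_keys {m. monomial_degree m \<le> d} (g - x ^ Suc d * h) \<in> J"
    using gr by (auto simp: graded_ideal_def)
  moreover have "restrict_keys {m. monomial_degree m \<le> d} g = g"
    using d by (intro poly_mapping_eqI) (auto simp: lookup_restrict_keys when_def in_keys_iff)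
  moreover have "restrict_keys {m. Suc d + monomial_degree m \<le> d} h = 0"
    by (intro poly_mapping_eqI) (auto simp: lookup_restrict_keys)
  ultimately show "g \<in> J"
    using restrict_keys_homogeneous_mult[OF homogeneous_power[OF x], of d "Suc d" h]
    by (simp add: restrict_keys_diff)
qed

text \<open>The graded setting allows \<open>x\<close> to move from the front to the end. If
  \<open>f * g\<close> lies in \<open>J\<close>, then \<open>g = x * h\<close> modulo
  \<open>J\<close>, and cancelling \<open>x\<close> shows that \<open>f * h\<close> lies in
  \<open>J\<close> as well; so the annihilator of \<open>f\<close> modulo \<open>J\<close> is
  divisible by every power of \<open>x\<close> and vanishes. That \<open>x\<close> stays regular
  modulo \<open>f\<close> is formal.\<close>

lemma weakly_regular_move_last:
  fixes J :: "('v::finite, 'k::comm_ring_1) mv_poly set"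
  assumes "ideal.subspace J" and "graded_ideal J" and "homogeneous 1 x"
    and "\<And>g. x * g \<in> J \<Longrightarrow> g \<in> J"
    and "\<And>f. f \<in> set fs \<Longrightarrow> \<exists>e. homogeneous e f"
    and "weakly_regular (ideal.span (insert x J)) fs"
  shows "weakly_regular J (fs @ [x])"
  using assms
proof (induction fs arbitrary: J)
  case (Cons f fs)
  note sub = Cons.prems(1) and xreg = Cons.prems(4)
  obtain e where e: "homogeneous e f" using Cons.prems(5) by auto
  have regs: "g \<in> ideal.span (insert x J)" if "f * g \<in> ideal.span (insert x J)" for g
    using Cons.prems(6) that by simp
  have "{g. f * g \<in> J} \<subseteq> J"
  proof (rule subset_graded_ideal_if_divisible[OF sub Cons.prems(2,3)])
    fix g assume "g \<in> {g. f * g \<in> J}"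
    then have fg: "f * g \<in> J" by simp
    have "g \<in> ideal.span (insert x J)"
      by (rule regs, rule ideal.span_base) (simp add: fg)
    then obtain h where h: "g - x * h \<in> J" using mem_span_insert_iff[OF sub] by blast
    have "f * g - f * (g - x * h) \<in> J"
      using ideal.subspace_diff[OF sub fg ideal.subspace_scale[OF sub h]] .
    then have "x * (f * h) \<in> J" by (simp add: algebra_simps)
    then show "\<exists>h\<in>{g. f * g \<in> J}. g - x * h \<in> J" using h xreg by blast
  qed
  then have reg: "g \<in> J" if "f * g \<in> J" for g using that by blast
  let ?J = "ideal.span (insert f J)"
  have "weakly_regular ?J (fs @ [x])"
  proof (rule Cons.IH)
    show "graded_ideal ?J" using graded_ideal_span_insert[OF sub Cons.prems(2) e] .
    show "weakly_regular (ideal.span (insert x ?J)) fs"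
      using Cons.prems(6) by (simp add: span_insert_commute)
    fix g assume "x * g \<in> ?J"
    then obtain h where h: "x * g - f * h \<in> J" using mem_span_insert_iff[OF sub] by blast
    have "f * h - x * g \<in> J" using ideal.subspace_neg[OF sub h] by simp
    then have "f * h \<in> ideal.span (insert x J)" using mem_span_insert_iff[OF sub] by blast
    then obtain h' where h': "h - x * h' \<in> J" using regs mem_span_insert_iff[OF sub] by blast
    have "(x * g - f * h) + f * (h - x * h') \<in> J"
      using ideal.subspace_add[OF sub h ideal.subspace_scale[OF sub h']] .
    then have "x * (g - f * h') \<in> J" by (simp add: algebra_simps)
    then show "g \<in> ?J" using xreg mem_span_insert_iff[OF sub] by blast
  qed (use Cons.prems in auto)
  then show ?case using reg by simp
qed simp

section \<open>Regularity of the elementary symmetric polynomials\<close>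

definition esym :: "nat \<Rightarrow> ('v::finite, 'k::comm_ring_1) mv_poly" where
  "esym i = (\<Sum>A | card A = i. \<Prod>v\<in>A. Var v)"

lemma prod_Var:
  fixes A :: "'v::finite set"
  shows "(\<Prod>v\<in>A. Var v :: ('v, 'k::comm_ring_1) mv_poly) =
    Poly_Mapping.single (\<Sum>v\<in>A. Poly_Mapping.single v 1) 1"
  by (induction rule: finite_induct[OF finite[of A]]) (simp_all add: Var_def mult_single)

lemma homogeneous_Var: "homogeneous 1 (Var v)"
  by (simp add: homogeneous_def monomial_degree_def Var_def lookup_single when_def)

lemma homogeneous_esym: "homogeneous i (esym i)"
proof -
  have "monomial_degree (\<Sum>v\<in>A. Poly_Mapping.single v 1) = card A" for A :: "'a set"
    by (simp add: monomial_degree_def lookup_sum lookup_single when_def sum.If_cases)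
  then show ?thesis
    unfolding homogeneous_def esym_def prod_Var
    by (auto dest!: subsetD[OF keys_sum] split: if_splits)
qed

text \<open>Over a field, the prime ideal generated by the variables in \<open>Z\<close>.\<close>

definition variable_ideal :: "'v set \<Rightarrow> ('v, 'k::comm_ring_1) mv_poly set" where
  "variable_ideal Z = monomial_ideal {m. \<exists>z\<in>Z. Poly_Mapping.lookup m z \<noteq> 0}"

lemma upward_closed_variables: "upward_closed {m. \<exists>z\<in>Z. Poly_Mapping.lookup m z \<noteq> 0}"
  by (auto simp: upward_closed_def lookup_add)

lemma range_add_single:
  "range ((+) (Poly_Mapping.single x (1::nat))) = {m. Poly_Mapping.lookup m x \<noteq> 0}"
proof (intro set_eqI iffI)
  fix m :: "'a \<Rightarrow>\<^sub>0 nat" assume "m \<in> {m. Poly_Mapping.lookup m x \<noteq> 0}"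
  then have "m = Poly_Mapping.single x 1 + (m - Poly_Mapping.single x 1)"
    by (intro poly_mapping_eqI) (auto simp: lookup_add lookup_minus lookup_single when_def)
  then show "m \<in> range ((+) (Poly_Mapping.single x 1))" by blast
qed (auto simp: lookup_add)

lemma variable_ideal_insert:
  "ideal.span (insert (Var x) (variable_ideal Z)) = variable_ideal (insert x Z)"
  unfolding variable_ideal_def Var_def span_insert_monomial_ideal[OF upward_closed_variables]
    range_add_single
  by (rule arg_cong[of _ _ monomial_ideal]) auto

lemma weakly_regular_appendD: "weakly_regular J (fs @ gs) \<Longrightarrow> weakly_regular J fs"
  by (induction fs arbitrary: J) auto

text \<open>Induction on the number of variables outside \<open>Z\<close>, say \<open>n + 1\<close>.
  Killing one of them, \<open>x\<close>, leaves \<open>n\<close>, where \<open>esym 1\<close> to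
  \<open>esym n\<close> are regular by induction; moving \<open>x\<close> last makes
  \<open>x\<close> regular after them. This holds for each remaining variable, hence for their
  product, which is \<open>esym (n + 1)\<close> modulo \<open>Z\<close>. A shorter sequence is a
  prefix.\<close>

lemma weakly_regular_esym:
  assumes "t \<le> card (- Z)"
  shows "weakly_regular (variable_ideal Z :: ('v::finite, 'k::comm_ring_1) mv_poly set)
    (map esym [1..<Suc t])"
  using assms
proof (induction "card (- Z)" arbitrary: Z t)
  case (Suc n)
  let ?J = "variable_ideal Z :: ('v, 'k) mv_poly set"
  have sub: "ideal.subspace ?J"
    unfolding variable_ideal_def by (intro subspace_monomial_ideal upward_closed_variables)
  have snoc: "weakly_regular ?J (map esym [1..<Suc n] @ [Var x])" if "x \<notin> Z" for x
  proof (rule weakly_regular_move_last[OF sub _ homogeneous_Var])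
    show "graded_ideal ?J"
      by (auto simp: graded_ideal_def variable_ideal_def monomial_ideal_def keys_restrict_keys)
    have "n = card (- insert x Z)"
      using Suc.hyps(2) that by (simp add: Compl_insert)
    then show "weakly_regular (ideal.span (insert (Var x) ?J)) (map esym [1..<Suc n])"
      unfolding variable_ideal_insert by (intro Suc.hyps(1)) auto
    show "\<exists>e. homogeneous e f" if "f \<in> set (map esym [1..<Suc n])" for f :: "('v, 'k) mv_poly"
      using that homogeneous_esym by auto
    have "{m. Poly_Mapping.single x (1::nat) + m \<in> {m. \<exists>z\<in>Z. Poly_Mapping.lookup m z \<noteq> 0}} =
        {m. \<exists>z\<in>Z. Poly_Mapping.lookup m z \<noteq> 0}"
      using that by (auto simp: lookup_add lookup_single when_def)
    then have "{g. Var x * g \<in> ?J} = ?J"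
      unfolding variable_ideal_def Var_def colon_monomial_ideal by (simp only:)
    then show "g \<in> ?J" if "Var x * g \<in> ?J" for g using that by blast
  qed
  have "- Z \<noteq> {}" using Suc.hyps(2) by auto
  then obtain x0 where x0: "x0 \<notin> Z" by blast
  have init: "weakly_regular ?J (map esym [1..<Suc n])"
    using snoc[OF x0] weakly_regular_snoc by blast
  show ?case
  proof (cases "t = Suc n")
    case True
    define K where "K = foldl (\<lambda>J f. ideal.span (insert f J)) ?J (map esym [1..<Suc n])"
    have subK: "ideal.subspace K"
      unfolding K_def by (rule subspace_foldl_span_insert[OF sub])
    have var: "g \<in> K" if "Var x * g \<in> K" "x \<notin> Z" for x g
      using snoc[OF that(2)] that(1) unfolding K_def weakly_regular_snoc by blast
    have prod: "g \<in> K" if "(\<Prod>v\<in>A. Var v) * g \<in> K" "A \<subseteq> - Z" for A g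
      using finite[of A] that
    proof (induction A arbitrary: g rule: finite_induct)
      case (insert v A)
      then have "Var v * ((\<Prod>v\<in>A. Var v) * g) \<in> K" by (simp add: mult.assoc)
      then have "(\<Prod>v\<in>A. Var v) * g \<in> K" by (rule var) (use insert.prems in simp)
      then show ?case using insert by auto
    qed simp
    \<comment> \<open>A set of \<open>Suc n\<close> variables other than \<open>- Z\<close> must
      meet \<open>Z\<close>, so all other products vanish modulo \<open>Z\<close>.\<close>
    have "esym (Suc n) - (\<Prod>v\<in>- Z. Var v) = (\<Sum>A\<in>{A. card A = Suc n} - {- Z}. \<Prod>v\<in>A. Var v :: ('v, 'k) mv_poly)"
      unfolding esym_def using Suc.hyps(2) by (subst sum.remove[of _ "- Z"]) auto
    also have "\<dots> \<in> ?J"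
    proof (rule ideal.subspace_sum[OF sub])
      fix A assume A: "A \<in> {A. card A = Suc n} - {- Z}"
      then have "\<not> A \<subseteq> - Z" using Suc.hyps(2) card_subset_eq[of "- Z" A] by auto
      then obtain z where "z \<in> A" "z \<in> Z" by blast
      then show "(\<Prod>v\<in>A. Var v) \<in> ?J"
        unfolding prod_Var variable_ideal_def monomial_ideal_def
        by (auto simp: lookup_sum lookup_single when_def intro!: bexI[of _ z])
    qed
    finally have diff: "esym (Suc n) - (\<Prod>v\<in>- Z. Var v) \<in> K"
      unfolding K_def using subset_foldl_span_insert by blast
    have "g \<in> K" if g: "esym (Suc n) * g \<in> K" for g
    proof (rule prod[of "- Z"])
      have "esym (Suc n) * g - g * (esym (Suc n) - (\<Prod>v\<in>- Z. Var v)) \<in> K"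
        by (rule ideal.subspace_diff[OF subK g ideal.subspace_scale[OF subK diff]])
      then show "(\<Prod>v\<in>- Z. Var v) * g \<in> K" by (simp add: algebra_simps)
    qed simp
    then have "weakly_regular ?J (map esym [1..<Suc n] @ [esym (Suc n)])"
      using init unfolding K_def weakly_regular_snoc by blast
    then show ?thesis using True by simp
  next
    case False
    then have "t \<le> n" using Suc by simp
    have "[1..<Suc n] = [1..<Suc t] @ [Suc t..<Suc n]"
      using \<open>t \<le> n\<close> upt_add_eq_append[of 1 "Suc t" "n - t"] by simp
    then have "weakly_regular ?J (map esym [1..<Suc t] @ map esym [Suc t..<Suc n])"
      using init unfolding map_append[symmetric] by (simp only:)
    then show ?thesis by (rule weakly_regular_appendD)
  qed
qed simp

section \<open>Ideals generated by variables and quadrics\<close>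

definition mono_dvd :: "('v \<Rightarrow>\<^sub>0 nat) \<Rightarrow> ('v \<Rightarrow>\<^sub>0 nat) \<Rightarrow> bool" where
  "mono_dvd f m \<longleftrightarrow> (\<forall>w. Poly_Mapping.lookup f w \<le> Poly_Mapping.lookup m w)"

lemma mono_dvdD: "mono_dvd f m \<Longrightarrow> Poly_Mapping.lookup f w \<le> Poly_Mapping.lookup m w"
  by (simp add: mono_dvd_def)

lemma mono_dvd_iff_add: "mono_dvd f m \<longleftrightarrow> (\<exists>m'. m = f + m')"
proof
  assume "mono_dvd f m"
  then have "m = f + (m - f)"
    by (intro poly_mapping_eqI) (simp add: lookup_add lookup_minus mono_dvd_def)
  then show "\<exists>m'. m = f + m'" by blast
qed (auto simp: mono_dvd_def lookup_add)

lemma range_add_eq_mono_dvd: "range ((+) f) = {m. mono_dvd f m}"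
  by (auto simp: mono_dvd_iff_add)

lemma mono_dvd_add: "mono_dvd f m \<Longrightarrow> mono_dvd f (m + m')"
  by (simp add: mono_dvd_def lookup_add trans_le_add1)

definition quadric :: "'v \<Rightarrow> 'v \<Rightarrow> 'v \<Rightarrow>\<^sub>0 nat" where
  "quadric u v = Poly_Mapping.single u 1 + Poly_Mapping.single v 1"

lemma lookup_quadric: "Poly_Mapping.lookup (quadric u v) w = of_bool (w = u) + of_bool (w = v)"
  by (auto simp: quadric_def lookup_add lookup_single when_def)

lemma lookup_add_single:
  "Poly_Mapping.lookup (Poly_Mapping.single x (1::nat) + m) w = of_bool (w = x) + Poly_Mapping.lookup m w"
  by (auto simp: lookup_add lookup_single when_def)

lemma quadric_commute: "quadric u v = quadric v u"
  by (simp add: quadric_def add.commute)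

lemma mono_dvd_quadric_iff:
  "mono_dvd (quadric u v) m \<longleftrightarrow> Poly_Mapping.lookup m u \<noteq> 0 \<and> Poly_Mapping.lookup m v \<noteq> 0
    \<and> (u = v \<longrightarrow> 2 \<le> Poly_Mapping.lookup m u)"
proof
  assume "mono_dvd (quadric u v) m"
  from mono_dvdD[OF this, of u] mono_dvdD[OF this, of v]
  show "Poly_Mapping.lookup m u \<noteq> 0 \<and> Poly_Mapping.lookup m v \<noteq> 0
      \<and> (u = v \<longrightarrow> 2 \<le> Poly_Mapping.lookup m u)"
    by (auto simp: lookup_quadric split: if_splits)
qed (auto simp: mono_dvd_def lookup_quadric of_bool_def Suc_le_eq)

definition quadric_upset :: "'v set \<Rightarrow> ('v \<times> 'v) set \<Rightarrow> ('v \<Rightarrow>\<^sub>0 nat) set" where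
  "quadric_upset Z Q =
     {m. (\<exists>z\<in>Z. Poly_Mapping.lookup m z \<noteq> 0) \<or> (\<exists>(u, v)\<in>Q. mono_dvd (quadric u v) m)}"

lemma upward_closed_quadric_upset: "upward_closed (quadric_upset Z Q)"
  by (fastforce simp: upward_closed_def quadric_upset_def lookup_add intro: mono_dvd_add)

lemma quadric_upset_insert:
  "quadric_upset Z Q \<union> range ((+) (Poly_Mapping.single x 1)) = quadric_upset (insert x Z) Q"
  unfolding range_add_single by (auto simp: quadric_upset_def)

text \<open>A quadric dividing \<open>x m\<close> but not \<open>m\<close> contains
  \<open>x\<close>, and its other variable divides \<open>m\<close>; for the square of
  \<open>x\<close> that variable is \<open>x\<close> itself. With \<open>x\<close> in
  \<open>Z\<close> the colon would be the whole ring.\<close>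

lemma quadric_upset_colon:
  assumes "sym Q" "x \<notin> Z"
  shows "{m. Poly_Mapping.single x 1 + m \<in> quadric_upset Z Q} = quadric_upset (Z \<union> Q `` {x}) Q"
proof (intro set_eqI iffI)
  fix m assume "m \<in> {m. Poly_Mapping.single x 1 + m \<in> quadric_upset Z Q}"
  then consider z where "z \<in> Z" "Poly_Mapping.lookup (Poly_Mapping.single x 1 + m) z \<noteq> 0"
    | u v where "(u, v) \<in> Q" "mono_dvd (quadric u v) (Poly_Mapping.single x 1 + m)"
    unfolding quadric_upset_def by blast
  then show "m \<in> quadric_upset (Z \<union> Q `` {x}) Q"
  proof cases
    case 1
    then have "Poly_Mapping.lookup m z \<noteq> 0" using assms(2) by (auto simp: lookup_add_single simp del: One_nat_def)
    then show ?thesis using 1 by (auto simp: quadric_upset_def)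
  next
    case 2
    show ?thesis
    proof (cases "mono_dvd (quadric u v) m")
      case True
      then show ?thesis using 2 by (auto simp: quadric_upset_def)
    next
      case False
      then have "u = x \<and> Poly_Mapping.lookup m v \<noteq> 0 \<or> v = x \<and> Poly_Mapping.lookup m u \<noteq> 0"
        using 2(2) unfolding mono_dvd_quadric_iff lookup_add_single of_bool_def
        by (auto split: if_splits)
      then show ?thesis using 2(1) symD[OF assms(1) 2(1)] by (auto simp: quadric_upset_def)
    qed
  qed
next
  fix m assume "m \<in> quadric_upset (Z \<union> Q `` {x}) Q"
  then consider z where "z \<in> Z" "Poly_Mapping.lookup m z \<noteq> 0"
    | z where "(x, z) \<in> Q" "Poly_Mapping.lookup m z \<noteq> 0"
    | u v where "(u, v) \<in> Q" "mono_dvd (quadric u v) m"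
    unfolding quadric_upset_def by blast
  then show "m \<in> {m. Poly_Mapping.single x 1 + m \<in> quadric_upset Z Q}"
  proof cases
    case 1
    then show ?thesis by (auto simp: quadric_upset_def lookup_add)
  next
    case 2
    then have "mono_dvd (quadric x z) (Poly_Mapping.single x 1 + m)"
      unfolding mono_dvd_quadric_iff lookup_add_single by auto
    then show ?thesis using 2 unfolding quadric_upset_def by blast
  next
    case 3
    then have "mono_dvd (quadric u v) (Poly_Mapping.single x 1 + m)"
      by (subst add.commute) (rule mono_dvd_add)
    then show ?thesis using 3 unfolding quadric_upset_def by blast
  qed
qed

lemma quadric_upset_redundant:
  assumes "\<And>u v. (u, v) \<in> P \<Longrightarrow> u \<in> Z \<or> v \<in> Z \<or> (u, v) \<in> E"
  shows "quadric_upset Z (E \<union> P) = quadric_upset Z E"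
  unfolding quadric_upset_def using assms by (fastforce simp: mono_dvd_quadric_iff)

text \<open>The type argument names the coefficient ring, which the exponent set \<open>U\<close>
  does not mention.\<close>

definition esym_regular :: "'k::comm_ring_1 itself \<Rightarrow> nat \<Rightarrow> ('v::finite \<Rightarrow>\<^sub>0 nat) set \<Rightarrow> bool" where
  "esym_regular K t U \<longleftrightarrow>
     weakly_regular (monomial_ideal U :: ('v, 'k) mv_poly set) (map esym [1..<Suc t])"

lemma esym_regular_split:
  assumes "upward_closed U"
    and "esym_regular K t {m. f + m \<in> U}" and "esym_regular K t (U \<union> range ((+) f))"
  shows "esym_regular K t U"
  using assms unfolding esym_regular_def by (rule weakly_regular_monomial_split)

lemma esym_regular_split_vertex:
  assumes "sym Q" "x \<notin> Z"
    and "esym_regular K t (quadric_upset (Z \<union> Q `` {x}) Q)"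
    and "esym_regular K t (quadric_upset (insert x Z) Q)"
  shows "esym_regular K t (quadric_upset Z Q)"
proof (rule esym_regular_split[OF upward_closed_quadric_upset])
  show "esym_regular K t {m. Poly_Mapping.single x 1 + m \<in> quadric_upset Z Q}"
    unfolding quadric_upset_colon[OF assms(1,2)] by (rule assms)
  show "esym_regular K t (quadric_upset Z Q \<union> range ((+) (Poly_Mapping.single x 1)))"
    unfolding quadric_upset_insert by (rule assms)
qed

text \<open>The vertices of \<open>F\<close> are isolated. For a vertex \<open>v\<close>, split on its neighbours one after the
  other: a colon by \<open>u\<close> costs at most \<open>2 * d\<close> vertices (\<open>N(u)\<close>, \<open>u\<close>, and at most \<open>d - 1\<close> earlier
  neighbours of \<open>v\<close>) and isolates \<open>u\<close>; deleting all neighbours costs \<open>d + 1\<close> vertices and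
  isolates \<open>v\<close>.\<close>

lemma esym_regular_graph:
  fixes Q :: "('v::finite \<times> 'v) set"
  assumes Q: "sym Q" "irrefl Q" "\<And>x. card (Q `` {x}) \<le> d" and d: "1 \<le> d"
    and "F \<inter> Z = {}" "\<And>x. x \<in> F \<Longrightarrow> Q `` {x} \<subseteq> Z"
    and "2 * d * t < card (- Z - F) + 2 * d * card F + 2 * d"
  shows "esym_regular K t (quadric_upset Z Q)"
  using assms(5-)
proof (induction "card (- Z - F)" arbitrary: Z F rule: less_induct)
  case less
  note IH = less.hyps and FZ = less.prems(1) and FQ = less.prems(2) and bound = less.prems(3)
  show ?case
  proof (cases "- Z - F = {}")
    case True
    then have F: "F = - Z" using FZ by blast
    \<comment> \<open>The bound is a potential in which an isolated vertex counts
      \<open>2 * d\<close> and an undecided one counts 1. With nothing undecided, the spare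
      \<open>2 * d\<close> yields \<open>t < card F + 1\<close>, and \<open>F\<close> is the set of
      variables left over.\<close>
    have "2 * d * t < 2 * d * Suc (card F)" using bound unfolding True by simp
    then have "t < Suc (card F)" by (metis mult_less_cancel1)
    moreover have "quadric_upset Z Q = {m. \<exists>z\<in>Z. Poly_Mapping.lookup m z \<noteq> 0}"
    proof -
      have "u \<in> Z \<or> v \<in> Z" if "(u, v) \<in> Q" for u v
        using FQ[of u] that F by blast
      then show ?thesis unfolding quadric_upset_def by (fastforce simp: mono_dvd_quadric_iff)
    qed
    ultimately show ?thesis
      using weakly_regular_esym[of t Z] F
      unfolding esym_regular_def variable_ideal_def by simp
  next
    case False
    then obtain v where v: "v \<notin> Z" "v \<notin> F" by blast
    define N where "N = Q `` {v} - Z"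
    have N: "card N \<le> d"
      using Q(3)[of v] card_mono[of "Q `` {v}" N] unfolding N_def by fastforce
    have vN: "v \<notin> N" using Q(2) by (auto simp: N_def irrefl_def)
    have FN: "F \<inter> Q `` {v} = {}" using FQ v symD[OF Q(1)] by blast
    \<comment> \<open>Generalised over the set \<open>X\<close> of neighbours of \<open>v\<close>
      deleted so far, for an inner induction that ends at \<open>X = N\<close>.\<close>
    have "esym_regular K t (quadric_upset (Z \<union> X) Q)" if "X \<subseteq> N" for X
      using that
    proof (induction "card (N - X)" arbitrary: X rule: less_induct)
      case (less X)
      note IHX = less.hyps and XN = less.prems
      show ?case
      proof (cases "X = N")
        case True
        have eq: "- (Z \<union> N) - insert v F = (- Z - F) - insert v N" by blast
        have lt: "card (- (Z \<union> N) - insert v F) < card (- Z - F)"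
          unfolding eq using v by (intro psubset_card_mono) auto
        have "card (- Z - F) - card (insert v N) \<le> card (- (Z \<union> N) - insert v F)"
          unfolding eq by (rule diff_card_le_card_Diff) simp
        \<comment> \<open>Since \<open>1 \<le> d\<close>, this cost is within the
          \<open>2 * d\<close> gained by isolating \<open>v\<close>.\<close>
        moreover have "card (insert v N) \<le> d + 1" using N vN by simp
        ultimately have ge: "card (- Z - F) \<le> card (- (Z \<union> N) - insert v F) + 2 * d"
          using d by linarith
        have cF: "2 * d * card (insert v F) = 2 * d * card F + 2 * d" using v by simp
        show ?thesis unfolding True
        proof (rule IH[OF lt])
          show "insert v F \<inter> (Z \<union> N) = {}" using FZ FN v vN by (auto simp: N_def)
          show "Q `` {x} \<subseteq> Z \<union> N" if "x \<in> insert v F" for x using FQ that by (auto simp: N_def)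
          show "2 * d * t < card (- (Z \<union> N) - insert v F) + 2 * d * card (insert v F) + 2 * d"
            using bound ge unfolding cF by linarith
        qed
      next
        case False
        then obtain u where u: "u \<in> N" "u \<notin> X" using XN by blast
        have uv: "(u, v) \<in> Q" using u(1) symD[OF Q(1)] by (auto simp: N_def)
        have uF: "u \<notin> F" using u(1) FN by (auto simp: N_def)
        have uu: "(u, u) \<notin> Q" using Q(2) by (auto simp: irrefl_def)
        show ?thesis
        proof (rule esym_regular_split_vertex[OF Q(1)])
          show "u \<notin> Z \<union> X" using u by (auto simp: N_def)
          have "card (N - insert u X) < card (N - X)" using u by (intro psubset_card_mono) auto
          then show "esym_regular K t (quadric_upset (insert u (Z \<union> X)) Q)"
            using IHX[of "insert u X"] XN u(1) by simp
          let ?Z = "Z \<union> X \<union> Q `` {u}"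
          have eq: "- ?Z - insert u F = (- Z - F) - insert u (X \<union> Q `` {u})" by blast
          have lt: "card (- ?Z - insert u F) < card (- Z - F)"
            unfolding eq using v uv by (intro psubset_card_mono) auto
          have "card X < card N" using XN False by (intro psubset_card_mono) auto
          moreover have "card (insert u (X \<union> Q `` {u})) \<le> Suc (card X + card (Q `` {u}))"
            by (rule order_trans[OF card_insert_le_m1[of "Suc (card X + card (Q `` {u}))"]]) (simp_all add: card_Un_le)
          ultimately have "card (insert u (X \<union> Q `` {u})) \<le> 2 * d"
            using N Q(3)[of u] by linarith
          moreover have "card (- Z - F) - card (insert u (X \<union> Q `` {u})) \<le> card (- ?Z - insert u F)"
            unfolding eq by (rule diff_card_le_card_Diff) simp
          ultimately have ge: "card (- Z - F) \<le> card (- ?Z - insert u F) + 2 * d" by linarith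
          have cF: "2 * d * card (insert u F) = 2 * d * card F + 2 * d" using uF by simp
          show "esym_regular K t (quadric_upset ?Z Q)"
          proof (rule IH[OF lt])
            have "x \<notin> F" if "(u, x) \<in> Q" for x
              using FQ[of x] symD[OF Q(1) that] u(1) by (auto simp: N_def)
            then show "insert u F \<inter> ?Z = {}"
              using FZ FN uu u XN by (auto simp: N_def)
            show "Q `` {x} \<subseteq> ?Z" if "x \<in> insert u F" for x using FQ that by auto
            show "2 * d * t < card (- ?Z - insert u F) + 2 * d * card (insert u F) + 2 * d"
              using bound ge unfolding cF by linarith
          qed
        qed
      qed
    qed
    from this[of "{}"] show ?thesis by simp
  qed
qed

section \<open>The square of an edge ideal\<close>

definition edge_monomials :: "('v \<times> 'v) set \<Rightarrow> ('v \<Rightarrow>\<^sub>0 nat) set" where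
  "edge_monomials E = {quadric u v | u v. (u, v) \<in> E}"

text \<open>The monomials of \<open>I\<^sup>2 + (X)\<close>, where \<open>I\<close> is the edge ideal.\<close>

definition square_upset ::
  "('v \<times> 'v) set \<Rightarrow> ('v \<Rightarrow>\<^sub>0 nat) set \<Rightarrow> ('v \<Rightarrow>\<^sub>0 nat) set" where
  "square_upset E X = {m. (\<exists>f\<in>edge_monomials E. \<exists>g\<in>edge_monomials E. mono_dvd (f + g) m)
     \<or> (\<exists>f\<in>X. mono_dvd f m)}"

lemma upward_closed_square_upset: "upward_closed (square_upset E X)"
  unfolding upward_closed_def square_upset_def using mono_dvd_add by blast

lemma square_upset_insert: "square_upset E X \<union> range ((+) f) = square_upset E (insert f X)"
  unfolding range_add_eq_mono_dvd by (auto simp: square_upset_def)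

text \<open>Products of two edges are redundant once every edge is a generator; this is where the
  splitting by edges ends.\<close>

lemma square_upset_all: "square_upset E (edge_monomials E) = quadric_upset {} E"
proof -
  have "mono_dvd f m" if "mono_dvd (f + g) m" for f g m :: "'a \<Rightarrow>\<^sub>0 nat"
    using that by (auto simp: mono_dvd_def lookup_add intro: add_leD1)
  then show ?thesis unfolding square_upset_def quadric_upset_def edge_monomials_def by blast
qed

text \<open>The ends of walks \<open>y - a - b - y'\<close>, that is, the even-connected pairs with
  respect to the single edge \<open>ab\<close>. A common neighbour of \<open>a\<close> and
  \<open>b\<close> contributes a diagonal pair.\<close>

definition even_connections :: "('v \<times> 'v) set \<Rightarrow> 'v \<Rightarrow> 'v \<Rightarrow> ('v \<times> 'v) set" where
  "even_connections E a b = E `` {a} \<times> E `` {b} \<union> E `` {b} \<times> E `` {a}"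

lemma sym_even_connections: "sym (even_connections E a b)"
  by (auto simp: even_connections_def sym_def)

text \<open>Without loops each end of the edge has exponent 1, so an end absent from
  \<open>m\<close> must be supplied by \<open>a b\<close>. Symmetry of \<open>E\<close> lets this
  end come first.\<close>

lemma edge_monomial_not_dvd:
  assumes "sym E" "irrefl E" "(a, b) \<in> E" "f \<in> edge_monomials E" "\<not> mono_dvd f m"
    and "mono_dvd f (quadric a b + m)"
  obtains p q where "f = quadric p q" "(p, q) \<in> E" "p = a \<or> p = b" "Poly_Mapping.lookup m p = 0"
proof -
  obtain u v where f: "f = quadric u v" "(u, v) \<in> E" using assms(4) by (auto simp: edge_monomials_def)
  have "u \<noteq> v" using f assms(2) by (auto simp: irrefl_def)
  then consider "Poly_Mapping.lookup m u = 0" | "Poly_Mapping.lookup m v = 0"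
    using assms(5) f by (auto simp: mono_dvd_quadric_iff)
  then show thesis
  proof cases
    case 1
    then show thesis
      using mono_dvdD[OF assms(6), of u] f that[of u v]
      by (auto simp: lookup_quadric lookup_add of_bool_def split: if_splits)
  next
    case 2
    then show thesis
      using mono_dvdD[OF assms(6), of v] f that[of v u] symD[OF assms(1) f(2)]
      by (auto simp: lookup_quadric lookup_add of_bool_def quadric_commute split: if_splits)
  qed
qed

text \<open>Let a generator divide \<open>a b m\<close>. A member of \<open>X\<close> not dividing
  \<open>m\<close> shares exactly one vertex with \<open>ab\<close>, and its other vertex divides
  \<open>m\<close>. If neither factor of a product of two edges divides \<open>m\<close>, the
  factors use up \<open>a\<close> and \<open>b\<close> between them, and their other ends form an
  even connection dividing \<open>m\<close>. Conversely, \<open>a b u v\<close> regroups as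
  \<open>(a u) (b v)\<close>.\<close>

lemma square_upset_colon:
  assumes E: "sym E" "irrefl E" and ab: "(a, b) \<in> E"
    and X: "X \<subseteq> edge_monomials E" "quadric a b \<notin> X"
  shows "{m. quadric a b + m \<in> square_upset E X} =
    quadric_upset {y. quadric a y \<in> X \<or> quadric b y \<in> X} (E \<union> even_connections E a b)"
    (is "_ = quadric_upset ?Y ?Q")
proof (intro set_eqI iffI)
  have anb: "a \<noteq> b" using E(2) ab by (auto simp: irrefl_def)
  fix m
  have edge: "m \<in> quadric_upset ?Y ?Q" if "f \<in> edge_monomials E" "mono_dvd f m" for f
    using that by (auto simp: quadric_upset_def edge_monomials_def)
  assume "m \<in> {m. quadric a b + m \<in> square_upset E X}"
  then consider f where "f \<in> X" "mono_dvd f (quadric a b + m)"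
    | f g where "f \<in> edge_monomials E" "g \<in> edge_monomials E" "mono_dvd (f + g) (quadric a b + m)"
    unfolding square_upset_def by blast
  then show "m \<in> quadric_upset ?Y ?Q"
  proof cases
    case 1
    then have fE: "f \<in> edge_monomials E" using X by blast
    show ?thesis
    proof (cases "mono_dvd f m")
      case True
      then show ?thesis using edge fE by blast
    next
      case False
      obtain p q where pq: "f = quadric p q" "(p, q) \<in> E" "p = a \<or> p = b"
        using edge_monomial_not_dvd[OF E ab fE False 1(2)] .
      have "p \<noteq> q" using E(2) pq(2) by (auto simp: irrefl_def)
      moreover have "q \<noteq> a \<or> p \<noteq> b" "q \<noteq> b \<or> p \<noteq> a"
        using 1(1) X(2) pq(1) quadric_commute[of a b] by auto
      ultimately have "q \<noteq> a" "q \<noteq> b" using pq(3) by auto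
      then have "Poly_Mapping.lookup m q \<noteq> 0"
        using mono_dvdD[OF 1(2), of q] pq(1) by (auto simp: lookup_quadric lookup_add)
      moreover have "q \<in> ?Y" using pq 1(1) by auto
      ultimately show ?thesis by (auto simp: quadric_upset_def)
    qed
  next
    case 2
    have fd: "mono_dvd f (quadric a b + m)" and gd: "mono_dvd g (quadric a b + m)"
      using 2(3) unfolding mono_dvd_def lookup_add by (meson add_leD1 add_leD2)+
    show ?thesis
    proof (cases "mono_dvd f m \<or> mono_dvd g m")
      case True
      then show ?thesis using edge 2 by blast
    next
      case False
      obtain p q where pq: "f = quadric p q" "(p, q) \<in> E" "p = a \<or> p = b" "Poly_Mapping.lookup m p = 0"
        using edge_monomial_not_dvd[OF E ab 2(1) _ fd] False by blast
      obtain r s where rs: "g = quadric r s" "(r, s) \<in> E" "r = a \<or> r = b" "Poly_Mapping.lookup m r = 0"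
        using edge_monomial_not_dvd[OF E ab 2(2) _ gd] False by blast
      have neq: "p \<noteq> q" "r \<noteq> s" using E(2) pq(2) rs(2) by (auto simp: irrefl_def)
      have le: "of_bool (w = p) + of_bool (w = q) + (of_bool (w = r) + of_bool (w = s))
          \<le> of_bool (w = a) + of_bool (w = b) + Poly_Mapping.lookup m w" for w
        using mono_dvdD[OF 2(3), of w] unfolding pq(1) rs(1) lookup_add lookup_quadric .
      \<comment> \<open>Being absent from \<open>m\<close>, the vertices \<open>p\<close> and
        \<open>r\<close> have exponent 1 in \<open>a b m\<close>, so each occurs once among
        \<open>p, q, r, s\<close>. Thus \<open>q\<close> and \<open>s\<close> come from
        \<open>m\<close>, with exponent at least 2 if they coincide.\<close>
      have "p \<noteq> r" "q \<noteq> r" "s \<noteq> p"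
        using le[of p] le[of r] pq(3,4) rs(3,4) anb by (auto simp: of_bool_def split: if_splits)
      then have "q \<noteq> a" "q \<noteq> b" "s \<noteq> a" "s \<noteq> b" and ab: "p = a \<and> r = b \<or> p = b \<and> r = a"
        using neq pq(3) rs(3) by auto
      then have "mono_dvd (quadric q s) m"
        using le[of q] le[of s] unfolding mono_dvd_quadric_iff
        by (auto simp: of_bool_def split: if_splits)
      moreover have "(q, s) \<in> ?Q" using ab pq(2) rs(2) by (auto simp: even_connections_def)
      ultimately show ?thesis unfolding quadric_upset_def by blast
    qed
  qed
next
  fix m assume "m \<in> quadric_upset ?Y ?Q"
  then consider y c where "c = a \<or> c = b" "quadric c y \<in> X" "Poly_Mapping.lookup m y \<noteq> 0"
    | u v where "(u, v) \<in> E" "mono_dvd (quadric u v) m"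
    | u v where "(a, u) \<in> E" "(b, v) \<in> E" "mono_dvd (quadric u v) m"
    unfolding quadric_upset_def even_connections_def
    using quadric_commute by (fastforce simp: mono_dvd_quadric_iff)
  then show "m \<in> {m. quadric a b + m \<in> square_upset E X}"
  proof cases
    case 1
    then have "mono_dvd (quadric c y) (quadric a b + m)"
      by (auto simp: mono_dvd_def lookup_add lookup_quadric of_bool_def)
    then show ?thesis using 1 unfolding square_upset_def by blast
  next
    case 2
    then have "mono_dvd (quadric u v + quadric a b) (quadric a b + m)"
      by (simp add: mono_dvd_def lookup_add)
    then show ?thesis using 2 ab unfolding square_upset_def edge_monomials_def by blast
  next
    case 3
    then have "mono_dvd (quadric a u + quadric b v) (quadric a b + m)"
      by (simp add: mono_dvd_def lookup_add lookup_quadric algebra_simps)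
    then show ?thesis using 3 unfolding square_upset_def edge_monomials_def by blast
  qed
qed

text \<open>Either all of \<open>T\<close> gets deleted, or a colon by some \<open>y\<close> in
  \<open>T\<close> absorbs the whole neighbourhood of \<open>a\<close> or of \<open>b\<close>. In
  both cases the even connections become redundant and a graph with deleted vertices
  remains.\<close>

lemma esym_regular_even_connections:
  fixes E :: "('v::finite \<times> 'v) set"
  assumes E: "sym E" "irrefl E" "\<And>x. card (E `` {x}) \<le> d" and d: "1 \<le> d"
    and bound: "2 * d * t + d < card (UNIV :: 'v set)" and ab: "(a, b) \<in> E"
    and "Z \<subseteq> (E `` {a} \<union> E `` {b}) - {a, b}"
  shows "esym_regular K t (quadric_upset Z (E \<union> even_connections E a b))"
proof -
  define T where "T = (E `` {a} \<union> E `` {b}) - {a, b}"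
  let ?P = "even_connections E a b"
  have graph: "esym_regular K t (quadric_upset W E)"
    if W: "W \<subseteq> E `` {a} \<union> E `` {b} \<union> E `` {y}" for W y
  proof -
    have "card W \<le> card (E `` {a} \<union> E `` {b} \<union> E `` {y})" using W by (simp add: card_mono)
    also have "\<dots> \<le> card (E `` {a}) + card (E `` {b}) + card (E `` {y})"
      using card_Un_le[of "E `` {a} \<union> E `` {b}" "E `` {y}"] card_Un_le[of "E `` {a}" "E `` {b}"]
      by linarith
    also have "\<dots> \<le> 3 * d" using E(3)[of a] E(3)[of b] E(3)[of y] by linarith
    \<comment> \<open>The origin of the summand \<open>d\<close> in \<open>bound\<close>: at most
      \<open>3 * d\<close> variables are lost, and \<open>esym_regular_graph\<close> has
      \<open>2 * d\<close> to spare.\<close>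
    finally have "2 * d * t < card (- W - {}) + 2 * d * card ({} :: 'v set) + 2 * d"
      using bound card_Diff_subset[of W UNIV] by (simp add: Compl_eq_Diff_UNIV)
    then show ?thesis using esym_regular_graph[OF E d, of "{}"] by simp
  qed
  have "Z \<subseteq> T" using assms(7) by (simp add: T_def)
  then show ?thesis
  proof (induction "card (T - Z)" arbitrary: Z rule: less_induct)
    case less
    show ?case
    proof (cases "Z = T")
      case True
      \<comment> \<open>An even connection avoiding \<open>T\<close> has both ends in
        \<open>{a, b}\<close>, and without loops it is the edge \<open>ab\<close> itself.\<close>
      have "quadric_upset Z (E \<union> ?P) = quadric_upset Z E"
        using ab symD[OF E(1) ab] E(2) unfolding True
        by (intro quadric_upset_redundant) (auto simp: T_def even_connections_def irrefl_def)
      moreover have "Z \<subseteq> E `` {a} \<union> E `` {b} \<union> E `` {a}" using True by (auto simp: T_def)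
      ultimately show ?thesis using graph by simp
    next
      case False
      then obtain y where y: "y \<in> T" "y \<notin> Z" using less.prems by blast
      show ?thesis
      proof (rule esym_regular_split_vertex[OF _ y(2)])
        show "sym (E \<union> ?P)" using E(1) sym_even_connections by (rule sym_Un)
        have "card (T - insert y Z) < card (T - Z)" using y by (intro psubset_card_mono) auto
        then show "esym_regular K t (quadric_upset (insert y Z) (E \<union> ?P))"
          using less y by simp
        let ?W = "Z \<union> (E \<union> ?P) `` {y}"
        \<comment> \<open>A neighbour \<open>y\<close> of one end of \<open>ab\<close> is evenly
          connected to all neighbours of the other end.\<close>
        have "E `` {a} \<subseteq> ?W \<or> E `` {b} \<subseteq> ?W" using y(1) by (auto simp: T_def even_connections_def)
        then have "quadric_upset ?W (E \<union> ?P) = quadric_upset ?W E"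
          by (intro quadric_upset_redundant) (unfold even_connections_def, blast)
        moreover have "?W \<subseteq> E `` {a} \<union> E `` {b} \<union> E `` {y}"
          using less.prems by (auto simp: T_def even_connections_def)
        ultimately show "esym_regular K t (quadric_upset ?W (E \<union> ?P))" using graph by simp
      qed
    qed
  qed
qed

text \<open>Induction on the edges not yet in \<open>X\<close>: adding \<open>ab\<close> enlarges
  \<open>X\<close>, and the colon by \<open>ab\<close> is an ideal of
  \<open>esym_regular_even_connections\<close>.\<close>

lemma esym_regular_square:
  fixes E :: "('v::finite \<times> 'v) set"
  assumes E: "sym E" "irrefl E" "\<And>x. card (E `` {x}) \<le> d" and d: "1 \<le> d"
    and bound: "2 * d * t + d < card (UNIV :: 'v set)"
    and "X \<subseteq> edge_monomials E"
  shows "esym_regular K t (square_upset E X)"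
  using assms(6)
proof (induction "card (edge_monomials E - X)" arbitrary: X rule: less_induct)
  case less
  have "f \<in> case_prod quadric ` E" if f: "f \<in> edge_monomials E" for f
  proof -
    from f obtain u v where "f = quadric u v" "(u, v) \<in> E" unfolding edge_monomials_def by blast
    then show ?thesis using image_eqI[of f "case_prod quadric" "(u, v)" E] by simp
  qed
  then have "edge_monomials E \<subseteq> case_prod quadric ` E" by (rule subsetI)
  then have fin: "finite (edge_monomials E)" by (rule finite_subset) simp
  show ?case
  proof (cases "X = edge_monomials E")
    case True
    have "esym_regular K t (quadric_upset {} E)"
      using esym_regular_graph[OF E d, of "{}" "{}" t] bound by simp
    then show ?thesis unfolding True square_upset_all .
  next
    case False
    then obtain a b where ab: "(a, b) \<in> E" "quadric a b \<notin> X"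
      using less.prems by (auto simp: edge_monomials_def)
    have abE: "quadric a b \<in> edge_monomials E" using ab by (auto simp: edge_monomials_def)
    have nb: "y \<in> E `` {c}" "y \<noteq> c" if cy: "quadric c y \<in> X" for c y
    proof -
      have "quadric c y \<in> edge_monomials E" using cy less.prems by (rule subsetD[rotated])
      then obtain u v where uv: "quadric c y = quadric u v" "(u, v) \<in> E"
        unfolding edge_monomials_def by blast
      have l: "of_bool (w = c) + of_bool (w = y) = (of_bool (w = u) + of_bool (w = v) :: nat)" for w
        unfolding lookup_quadric[symmetric] uv(1) ..
      have "u \<noteq> v" using uv(2) E(2) unfolding irrefl_def by blast
      then consider "c = u" "y = v" | "c = v" "y = u"
        using l[of c] l[of y] by (fastforce simp: of_bool_def split: if_splits)
      then have "y \<in> E `` {c} \<and> y \<noteq> c"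
        using uv(2) symD[OF E(1) uv(2)] \<open>u \<noteq> v\<close> by cases auto
      then show "y \<in> E `` {c}" "y \<noteq> c" by simp_all
    qed
    show ?thesis
    proof (rule esym_regular_split[OF upward_closed_square_upset])
      have "card (edge_monomials E - insert (quadric a b) X) < card (edge_monomials E - X)"
        using ab abE fin by (intro psubset_card_mono) auto
      then show "esym_regular K t (square_upset E X \<union> range ((+) (quadric a b)))"
        unfolding square_upset_insert using abE less.prems by (intro less.hyps) auto
      have "y \<in> (E `` {a} \<union> E `` {b}) - {a, b}" if "quadric a y \<in> X \<or> quadric b y \<in> X" for y
        using that
      proof
        assume y: "quadric a y \<in> X"
        then have "y \<noteq> b" using ab(2) by auto
        then show ?thesis using nb[OF y] by simp
      next
        assume y: "quadric b y \<in> X"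
        then have "y \<noteq> a" using ab(2) quadric_commute[of a b] by auto
        then show ?thesis using nb[OF y] by simp
      qed
      then have "{y. quadric a y \<in> X \<or> quadric b y \<in> X} \<subseteq> (E `` {a} \<union> E `` {b}) - {a, b}"
        by blast
      then show "esym_regular K t {m. quadric a b + m \<in> square_upset E X}"
        unfolding square_upset_colon[OF E(1,2) ab(1) less.prems ab(2)]
        by (rule esym_regular_even_connections[OF E d bound ab(1)])
    qed
  qed
qed

section \<open>The second power as a monomial ideal\<close>

lemma span_products:
  "ideal.span {p * q | p q. p \<in> monomial_ideal {f + m | f m. f \<in> B} \<and> q \<in> monomial_ideal {g + m | g m. g \<in> C}}
    = (monomial_ideal {f + g + m | f g m. f \<in> B \<and> g \<in> C} :: ('v, 'k::comm_ring_1) mv_poly set)"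
    (is "ideal.span ?P = monomial_ideal ?U")
proof
  have U: "upward_closed ?U"
    unfolding upward_closed_def by (fastforce simp: add.assoc)
  have "p * q \<in> monomial_ideal ?U"
    if pq: "p \<in> monomial_ideal {f + m | f m. f \<in> B}" "q \<in> monomial_ideal {g + m | g m. g \<in> C}"
    for p q :: "('v, 'k) mv_poly"
    unfolding monomial_ideal_def
  proof (rule CollectI, rule subsetI)
    fix x assume "x \<in> Poly_Mapping.keys (p * q)"
    then obtain a b where x: "x = a + b" "a \<in> Poly_Mapping.keys p" "b \<in> Poly_Mapping.keys q"
      by (rule mem_keys_multE)
    obtain f m where f: "a = f + m" "f \<in> B" using x pq unfolding monomial_ideal_def by blast
    obtain g m' where g: "b = g + m'" "g \<in> C" using x pq unfolding monomial_ideal_def by blast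
    have "x = f + g + (m + m')" using x f g by (simp add: ac_simps)
    then show "x \<in> ?U" using f g by blast
  qed
  then show "ideal.span ?P \<subseteq> (monomial_ideal ?U :: ('v, 'k) mv_poly set)"
    by (intro ideal.span_minimal subspace_monomial_ideal U) auto
  have gen: "Poly_Mapping.single f (1::'k) \<in> monomial_ideal {f + m | f m. f \<in> B}" if "f \<in> B" for f and B :: "('v \<Rightarrow>\<^sub>0 nat) set"
    unfolding span_monomials[symmetric] using that by (intro ideal.span_base) blast
  have "Poly_Mapping.single h (1::'k) \<in> ?P" if h: "h \<in> {f + g | f g. f \<in> B \<and> g \<in> C}" for h
  proof -
    obtain f g where h: "h = f + g" "f \<in> B" "g \<in> C" using h by blast
    have "Poly_Mapping.single h (1::'k) = Poly_Mapping.single f 1 * Poly_Mapping.single g 1"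
      by (simp add: mult_single h)
    then show ?thesis using gen[OF h(2)] gen[OF h(3)] by blast
  qed
  then have "ideal.span ((\<lambda>f. Poly_Mapping.single f (1::'k)) ` {f + g | f g. f \<in> B \<and> g \<in> C}) \<subseteq> ideal.span ?P"
    by (intro ideal.span_mono) blast
  moreover have "{h + m | h m. h \<in> {f + g | f g. f \<in> B \<and> g \<in> C}} = ?U" by blast
  ultimately show "monomial_ideal ?U \<subseteq> (ideal.span ?P :: ('v, 'k) mv_poly set)"
    unfolding span_monomials by simp
qed

lemma ideal_power_2_edge_ideal:
  "ideal_power (edge_ideal H :: ('v::finite, 'k::field) mv_poly set) 2 =
    monomial_ideal (square_upset (parcs H) {})"
proof -
  let ?M = "edge_monomials (parcs H)"
  have "{Var u * Var v | u v. (u, v) \<in> parcs H} = (\<lambda>f. Poly_Mapping.single f (1::'k)) ` ?M"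
    by (auto simp: Var_def mult_single edge_monomials_def quadric_def image_def)
  then have I: "edge_ideal H = (monomial_ideal {f + m | f m. f \<in> ?M} :: ('v, 'k) mv_poly set)"
    unfolding edge_ideal_def by (simp only: span_monomials)
  \<comment> \<open>\<open>ideal_power I 2\<close> unfolds to \<open>I (I R)\<close>; this removes
    the factor \<open>R\<close>.\<close>
  have one: "ideal.span {a * b | a b. a \<in> I \<and> b \<in> UNIV} = ideal.span I" for I :: "('v, 'k) mv_poly set"
  proof
    have "a * b \<in> ideal.span I" if "a \<in> I" for a b :: "('v, 'k) mv_poly"
      using ideal.span_scale[OF ideal.span_base[OF that], of b] by (simp add: mult.commute)
    then show "ideal.span {a * b | a b. a \<in> I \<and> b \<in> UNIV} \<subseteq> ideal.span I"
      by (intro ideal.span_minimal) auto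
    have "a \<in> {a * b | a b. a \<in> I \<and> b \<in> UNIV}" if "a \<in> I" for a
      using that by (intro CollectI exI[of _ a] exI[of _ 1]) simp
    then show "ideal.span I \<subseteq> ideal.span {a * b | a b. a \<in> I \<and> b \<in> UNIV}"
      by (intro ideal.span_mono) blast
  qed
  have "ideal.span (edge_ideal H :: ('v, 'k) mv_poly set) = edge_ideal H"
    unfolding edge_ideal_def by (rule ideal.span_span)
  then have "ideal_power (edge_ideal H :: ('v, 'k) mv_poly set) 2 =
      monomial_ideal {f + g + m | f g m. f \<in> ?M \<and> g \<in> ?M}"
    unfolding numeral_2_eq_2 ideal_power.simps one by (simp only: I span_products)
  also have "{f + g + m | f g m. f \<in> ?M \<and> g \<in> ?M} = square_upset (parcs H) {}"
    unfolding square_upset_def mono_dvd_iff_add by blast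
  finally show ?thesis .
qed

section \<open>Depth and connectivity\<close>

lemma graded_maximal_ideal_eq:
  "graded_maximal_ideal = (variable_ideal UNIV :: ('v::finite, 'k::field) mv_poly set)"
proof -
  have "range Var = (\<lambda>f. Poly_Mapping.single f (1::'k)) ` range (\<lambda>v::'v. Poly_Mapping.single v 1)"
    by (auto simp: Var_def)
  moreover have "{f + m | f m. f \<in> range (\<lambda>v::'v. Poly_Mapping.single v (1::nat))} =
      (\<Union>v. range ((+) (Poly_Mapping.single v (1::nat))))"
    by blast
  ultimately show ?thesis
    unfolding graded_maximal_ideal_def variable_ideal_def range_add_single
    by (simp only: span_monomials range_add_single) (rule arg_cong[of _ _ monomial_ideal], blast)
qed

lemma depth_quotient_ge:
  fixes J :: "('v::finite, 'k::field) mv_poly set"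
  assumes J: "ideal.subspace J" "J \<subseteq> graded_maximal_ideal"
    and reg: "weakly_regular J (map esym [1..<Suc t])"
  shows "enat t \<le> depth_quotient J"
proof -
  let ?fs = "map esym [1..<Suc t] :: ('v, 'k) mv_poly list"
  let ?m = "graded_maximal_ideal :: ('v, 'k) mv_poly set"
  \<comment> \<open>The sequence starts at 1 because \<open>esym 0\<close> is the unit 1.\<close>
  have "esym i \<in> ?m" if "1 \<le> i" for i
  proof -
    have "\<exists>v\<in>UNIV. Poly_Mapping.lookup m v \<noteq> 0"
      if "m \<in> Poly_Mapping.keys (esym i :: ('v, 'k) mv_poly)" for m
    proof (rule ccontr)
      assume "\<not> ?thesis"
      then have "monomial_degree m = 0" by (simp add: monomial_degree_def)
      then show False
        using homogeneous_esym[of i] that \<open>1 \<le> i\<close> by (auto simp: homogeneous_def)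
    qed
    then show ?thesis
      unfolding graded_maximal_ideal_eq variable_ideal_def monomial_ideal_def by blast
  qed
  then have fs: "set ?fs \<subseteq> ?m" by auto
  have "ideal.span (J \<union> set ?fs) \<subseteq> ?m"
    using J(2) fs by (intro ideal.span_minimal) (auto simp: graded_maximal_ideal_def)
  moreover have "1 \<notin> ?m"
    unfolding graded_maximal_ideal_eq variable_ideal_def monomial_ideal_def by simp
  ultimately have "ideal.span (J \<union> set ?fs) \<noteq> UNIV" by blast
  then have "regular_sequence_on_quotient J ?fs"
    unfolding regular_sequence_on_quotient_def using weakly_regular_span[OF J(1) reg] by blast
  then have "enat (length ?fs) \<in> {enat (length fs) | fs. set fs \<subseteq> ?m \<and> regular_sequence_on_quotient J fs}"
    using fs by blast
  then have "enat t \<le> Sup {enat (length fs) | fs. set fs \<subseteq> ?m \<and> regular_sequence_on_quotient J fs}"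
    by (intro Sup_upper) (simp only: length_map length_upt diff_Suc_1)
  then show ?thesis unfolding depth_quotient_def grade_on_quotient_def by simp
qed

text \<open>The non-neighbour \<open>u\<close> survives the deletion of the neighbours of
  \<open>v\<close>, while \<open>v\<close> becomes isolated.\<close>

lemma vertex_connectivity_le_degree:
  fixes G :: "'v::finite pair_pre_digraph"
  assumes G: "pair_graph G" and V: "pverts G = UNIV" and uv: "u \<noteq> v" "(v, u) \<notin> parcs G"
  shows "vertex_connectivity G \<le> card (parcs G `` {v})"
proof -
  interpret pair_graph G by (rule G)
  \<comment> \<open>\<open>connected\<close> means strongly connected after
    \<open>mk_symmetric\<close>, hence the closure \<open>?D\<close>.\<close>
  let ?W = "parcs G `` {v}" and ?D = "mk_symmetric (delete_vertices G (parcs G `` {v}))"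
  have loop: "(w, w) \<notin> parcs G" for w using pair_no_loops[of "(w, w)"] by auto
  have sym: "(a, b) \<in> parcs G \<Longrightarrow> (b, a) \<in> parcs G" for a b
    using pair_sym_arcs by (simp add: symmetric_def sym_def)
  have verts: "pverts ?D = - ?W"
    by (auto simp: mk_symmetric_def delete_vertices_def V)
  have arcs: "(a, b) \<notin> parcs ?D" if "a = v" for a b
    using sym that
    by (auto simp: mk_symmetric_def delete_vertices_def induce_subgraph_def)
  have "\<not> Digraph_Component.connected (delete_vertices G ?W)"
  proof
    assume "Digraph_Component.connected (delete_vertices G ?W)"
    moreover have "v \<in> pverts ?D" "u \<in> pverts ?D" unfolding verts using uv(2) loop by simp_all
    ultimately have "reachable (with_proj ?D) v u"
      unfolding connected_def strongly_connected_def with_proj_simps by blast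
    then show False
      unfolding reachable_def using uv(1) arcs by (auto elim: converse_rtrancl_on_cases)
  qed
  moreover have "?W \<subset> pverts G" using loop V by auto
  ultimately show ?thesis unfolding vertex_connectivity_def by (intro Least_le) blast
qed

theorem theorem4p2:
  fixes G :: "'v::finite pair_pre_digraph" and n k :: nat
  assumes "pair_graph G"
    and "pverts G = UNIV"
    and "n = card (pverts G)"
    and "\<not> complete_digraph n (with_proj G)"
    and "k = vertex_connectivity G"
  shows "ereal_of_enat (depth_quotient
           (ideal_power (edge_ideal (complement_graph G) :: ('v, 'k::field) mv_poly set) 2))
         \<ge> ereal (of_int (\<lceil>real k / (2 * (real n - real k - 1))\<rceil> - 1))"
proof -
  interpret pair_graph G by (rule assms(1))
  note V = assms(2) and n = assms(3)
  define E where "E = parcs (complement_graph G)"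
  have E: "(u, v) \<in> E \<longleftrightarrow> u \<noteq> v \<and> (u, v) \<notin> parcs G" for u v
    by (simp add: E_def complement_graph_def V)
  have symG: "(a, b) \<in> parcs G \<Longrightarrow> (b, a) \<in> parcs G" for a b
    using pair_sym_arcs by (simp add: symmetric_def sym_def)
  have loop: "(w, w) \<notin> parcs G" for w using pair_no_loops[of "(w, w)"] by auto
  have symE: "sym E" using symG by (auto simp: sym_def E)
  have irreflE: "irrefl E" by (auto simp: irrefl_def E)
  \<comment> \<open>The degrees of \<open>x\<close> in the two graphs add up to less than
    \<open>n\<close>, and the one in \<open>G\<close> is at least \<open>k\<close>. A vertex
    isolated in the complement is excluded: deleting its neighbours in \<open>G\<close> leaves a
    single vertex, which is connected.\<close>
  have deg: "card (E `` {x}) + k + 1 \<le> n" if ne: "E `` {x} \<noteq> {}" for x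
  proof -
    obtain u where "(x, u) \<in> E" using ne by blast
    then have "k \<le> card (parcs G `` {x})"
      unfolding assms(5) using E by (intro vertex_connectivity_le_degree[OF assms(1) V, of u]) auto
    moreover have "E `` {x} \<inter> parcs G `` {x} = {}" by (auto simp: E)
    then have "card (E `` {x} \<union> parcs G `` {x}) = card (E `` {x}) + card (parcs G `` {x})"
      by (intro card_Un_disjoint) auto
    moreover have "card (E `` {x} \<union> parcs G `` {x}) < n"
      unfolding n V using loop E by (intro psubset_card_mono) auto
    ultimately show ?thesis by linarith
  qed
  \<comment> \<open>An edge of the complement forces \<open>1 \<le> d\<close>, so the subtraction
    defining \<open>d\<close> is exact and the denominator is positive.\<close>
  have "parcs G \<noteq> {(u, v). (u, v) \<in> pverts G \<times> pverts G \<and> u \<noteq> v}"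
    using assms(4) n unfolding complete_digraph_pair_def by simp
  then obtain x y where xy: "(x, y) \<in> E" using loop by (auto simp: E V)
  then have ne: "E `` {x} \<noteq> {}" by blast
  then have "1 \<le> card (E `` {x})" by (simp add: Suc_le_eq card_gt_0_iff)
  moreover define d where "d = n - k - 1"
  ultimately have nd: "n = k + d + 1" and d: "1 \<le> d"
    using deg[OF ne] by linarith+
  have deg_le: "card (E `` {x}) \<le> d" for x
    using deg[of x] nd by (cases "E `` {x} = {}") auto
  \<comment> \<open>For \<open>k = 0\<close> the claimed bound is -1, which \<open>nat\<close>
    raises to 0. Otherwise \<open>t\<close> lies strictly below \<open>k / (2 d)\<close>, so
    \<open>2 * d * t < k = n - d - 1\<close>.\<close>
  define t where "t = nat (\<lceil>real k / (2 * real d)\<rceil> - 1)"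
  have "2 * d * t + d < n"
  proof (cases "t = 0")
    case False
    then have "real t < real k / (2 * real d)" unfolding t_def by linarith
    then have "2 * real d * real t < real k" using d by (simp add: field_simps)
    then have "real (2 * d * t) < real k" by simp
    then have "2 * d * t < k" by (simp only: of_nat_less_iff)
    then show ?thesis using nd by linarith
  qed (use nd in simp)
  then have "2 * d * t + d < card (UNIV :: 'v set)" using n V by simp
  then have "esym_regular TYPE('k) t (square_upset E {})"
    by (intro esym_regular_square[OF symE irreflE deg_le d]) auto
  then have reg: "weakly_regular (monomial_ideal (square_upset E {}) :: ('v, 'k) mv_poly set)
      (map esym [1..<Suc t])"
    by (simp only: esym_regular_def)
  have "m \<in> {m. \<exists>z\<in>UNIV. Poly_Mapping.lookup m z \<noteq> 0}" if mU: "m \<in> square_upset E {}" for m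
  proof -
    obtain u v g where "mono_dvd (quadric u v + g) m"
      using mU by (auto simp: square_upset_def edge_monomials_def)
    from mono_dvdD[OF this, of u] show ?thesis
      by (auto simp: lookup_add lookup_quadric intro!: exI[of _ u])
  qed
  then have "monomial_ideal (square_upset E {}) \<subseteq> (graded_maximal_ideal :: ('v, 'k) mv_poly set)"
    unfolding graded_maximal_ideal_eq variable_ideal_def monomial_ideal_def by blast
  then have "enat t \<le> depth_quotient
      (ideal_power (edge_ideal (complement_graph G) :: ('v, 'k) mv_poly set) 2)"
    unfolding ideal_power_2_edge_ideal E_def[symmetric]
    using reg by (intro depth_quotient_ge subspace_monomial_ideal upward_closed_square_upset)
  then have "ereal_of_enat (enat t) \<le> ereal_of_enat (depth_quotient
      (ideal_power (edge_ideal (complement_graph G) :: ('v, 'k) mv_poly set) 2))"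
    by (simp only: ereal_of_enat_le_iff)
  moreover have "real n - real k - 1 = real d" using nd by simp
  then have "of_int (\<lceil>real k / (2 * (real n - real k - 1))\<rceil> - 1) \<le> real t"
    unfolding t_def by simp
  ultimately show ?thesis
    by (metis ereal_less_eq(3) ereal_of_enat_simps(1) order_trans)
qed

end
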